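(* Let $P=(X,\prec)$ be a finite poset, let $x,y,z\in X$ be distinct elements, and let $t\ge 1$ be an integer. Then, for all integers $k,\ell\ge 0$, $$F(k,\ell+1)\cdot F(k+1,\ell)\ \ge\ F(k,\ell)\cdot F(k+1,\ell+1).$$ More generally, $$\Lambda_q(k,\ell+1)\cdot\Lambda_q(k+1,\ell)\ \geqslant_q\ \Lambda_q(k,\ell)\cdot\Lambda_q(k+1,\ell+1).$$ Even more generally, $$\Lambda_{\mathbf q}(k,\ell+1)\cdot\Lambda_{\mathbf q}(k+1,\ell)\ \geqslant_{\mathbf q}\ \Lambda_{\mathbf q}(k,\ell)\cdot\Lambda_{\mathbf q}(k+1,\ell+1).$$
   Context: Write $X=\{x_1,\dots,x_n\}$, labeled so that $x_i\mapsto i$ is a linear extension of $P$ (natural labeling), and let $\mathbf q=(q_1,\dots,q_n)$ be variables ($q$ is a single variable). $\mathrm{PP}(P,t)$ is the set of maps $T:X\to\{0,1,\dots,t\}$ with $T(v)\le T(w)$ whenever $v\prec w$. For integers $k,\ell\ge 0$ let $$\mathrm{SPP}(k,\ell):=\{T\in\mathrm{PP}(P,t): T(y)-T(x)=k\ \text{and}\ T(z)-T(y)=\ell\},$$ $$F(k,\ell):=|\mathrm{SPP}(k,\ell)|,\quad \Lambda_q(k,\ell):=\sum_{T\in\mathrm{SPP}(k,\ell)}q^{|T|},\quad \Lambda_{\mathbf q}(k,\ell):=\sum_{T\in\mathrm{SPP}(k,\ell)}q_1^{T(x_1)}\cdots q_n^{T(x_n)},$$ where $|T|:=\sum_{v\in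 X}T(v)$. For polynomials $G,H$ with real coefficients, $G\geqslant_q H$ (respectively $G\geqslant_{\mathbf q}H$) means that all coefficients of $G-H$ as a polynomial in $q$ (respectively in $q_1,\dots,q_n$) are nonnegative. *)

theory Defs
  imports
    Complex_Main
    "HOL-Library.FuncSet"
    "HOL-Library.Poly_Mapping"
    "HOL-Computational_Algebra.Polynomial"
begin

text \<open>A poset is given by a carrier \<open>X\<close> and its strict order, as in \<open>P = (X, \<prec>)\<close>;
  the relation is irrelevant outside \<open>X\<close>.\<close>

definition finite_poset :: "'a set \<Rightarrow> ('a \<Rightarrow> 'a \<Rightarrow> bool) \<Rightarrow> bool" where
  "finite_poset X prec \<longleftrightarrow> finite X \<and> irreflp_on X prec \<and> transp_on X prec"

definition natural_labeling :: "'a set \<Rightarrow> ('a \<Rightarrow> 'a \<Rightarrow> bool) \<Rightarrow> nat \<Rightarrow> (nat \<Rightarrow> 'a) \<Rightarrow> bool" where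
  "natural_labeling X prec n lab \<longleftrightarrow>
     bij_betw lab {1..n} X \<and> (\<forall>i\<in>{1..n}. \<forall>j\<in>{1..n}. prec (lab i) (lab j) \<longrightarrow> i < j)"

text \<open>Maps \<open>X \<rightarrow> {0..t}\<close> are extensional functions, so that each map on \<open>X\<close> is
  represented by exactly one HOL function and sets of maps are finite and counted correctly.\<close>

definition PP :: "'a set \<Rightarrow> ('a \<Rightarrow> 'a \<Rightarrow> bool) \<Rightarrow> nat \<Rightarrow> ('a \<Rightarrow> nat) set" where
  "PP X prec t = {T \<in> X \<rightarrow>\<^sub>E {0..t}. \<forall>v\<in>X. \<forall>w\<in>X. prec v w \<longrightarrow> T v \<le> T w}"

text \<open>The differences are taken in the integers, avoiding truncated subtraction.\<close>

definition SPP :: "'a set \<Rightarrow> ('a \<Rightarrow> 'a \<Rightarrow> bool) \<Rightarrow> nat \<Rightarrow> 'a \<Rightarrow> 'a \<Rightarrow> 'a \<Rightarrow> nat \<Rightarrow> nat \<Rightarrow> ('a \<Rightarrow> nat) set" where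
  "SPP X prec t x y z k l =
     {T \<in> PP X prec t. int (T y) - int (T x) = int k \<and> int (T z) - int (T y) = int l}"

definition F :: "'a set \<Rightarrow> ('a \<Rightarrow> 'a \<Rightarrow> bool) \<Rightarrow> nat \<Rightarrow> 'a \<Rightarrow> 'a \<Rightarrow> 'a \<Rightarrow> nat \<Rightarrow> nat \<Rightarrow> nat" where
  "F X prec t x y z k l = card (SPP X prec t x y z k l)"

definition Lambda_q ::
  "'a set \<Rightarrow> ('a \<Rightarrow> 'a \<Rightarrow> bool) \<Rightarrow> nat \<Rightarrow> 'a \<Rightarrow> 'a \<Rightarrow> 'a \<Rightarrow> nat \<Rightarrow> nat \<Rightarrow> real poly" where
  "Lambda_q X prec t x y z k l = (\<Sum>T\<in>SPP X prec t x y z k l. monom 1 (\<Sum>v\<in>X. T v))"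

definition geq_q :: "real poly \<Rightarrow> real poly \<Rightarrow> bool" (infix "\<ge>\<^sub>q" 50) where
  "G \<ge>\<^sub>q H \<longleftrightarrow> (\<forall>d. coeff (G - H) d \<ge> 0)"

text \<open>Polynomials in the variables \<open>q\<^sub>1, q\<^sub>2, \<dots>\<close>: finitely supported functions from monomials
  to coefficients, where a monomial is a finitely supported exponent vector. The multiplication
  of \<open>Poly_Mapping\<close> is convolution, which is the product of polynomials.\<close>

type_synonym qpoly = "(nat \<Rightarrow>\<^sub>0 nat) \<Rightarrow>\<^sub>0 real"

definition qvar :: "nat \<Rightarrow> qpoly" where
  "qvar i = Poly_Mapping.single (Poly_Mapping.single i 1) 1"

definition Lambda_qs ::
  "'a set \<Rightarrow> ('a \<Rightarrow> 'a \<Rightarrow> bool) \<Rightarrow> nat \<Rightarrow> (nat \<Rightarrow> 'a) \<Rightarrow> nat \<Rightarrow> 'a \<Rightarrow> 'a \<Rightarrow> 'a \<Rightarrow> nat \<Rightarrow> nat \<Rightarrow> qpoly" where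
  "Lambda_qs X prec n lab t x y z k l =
     (\<Sum>T\<in>SPP X prec t x y z k l. \<Prod>i=1..n. qvar i ^ T (lab i))"

definition geq_qs :: "qpoly \<Rightarrow> qpoly \<Rightarrow> bool" (infix "\<ge>\<^sub>q\<^sub>s" 50) where
  "G \<ge>\<^sub>q\<^sub>s H \<longleftrightarrow> (\<forall>m. Poly_Mapping.lookup (G - H) m \<ge> 0)"

end

theory Submission
  imports Defs
begin

text \<open>
  The three inequalities follow from one injection
  \<open>SPP(k, l) \<times> SPP(k + 1, l + 1) \<rightarrow> SPP(k, l + 1) \<times> SPP(k + 1, l)\<close> that keeps the pointwise sum
  of the two maps. The product of the monomials of a pair depends only on this sum, so the terms
  of the smaller side cancel, and what remains on the larger side is a sum of monomials.

  To build it, fix the sum \<open>S = A + B\<close> and describe a pair by its difference \<open>D = B - A\<close>.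
  Both maps are order preserving with values in \<open>{0..t}\<close> iff \<open>D\<close> satisfies the Lipschitz
  conditions \<open>\<bar>D v - D w\<bar> \<le> S w - S v\<close> for \<open>v \<prec> w\<close> and \<open>\<bar>D v\<bar> \<le> min (S v) (2 t - S v)\<close>.
  The latter compare \<open>D v\<close> with the value \<open>0\<close> at one additional vertex, so all conditions
  concern differences only, and \<open>D\<close> may be normalised to vanish at \<open>y\<close> instead of
  at the additional vertex. For the normalised difference \<open>E\<close> the problem is invariant under
  \<open>E \<mapsto> -E\<close>, even though the original ranges are not. A pair in
  \<open>SPP(k, l) \<times> SPP(k + 1, l + 1)\<close> has \<open>E x = -1\<close> and \<open>E z = 1\<close>, whereas a pair in the target has
  \<open>E x = E z = -1\<close>.

  It remains to change the sign at \<open>z\<close> but not at \<open>x\<close>. Join two vertices when a condition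
  between them would fail for opposite signs, and reverse the sign of \<open>E\<close> on the connected
  component of \<open>z\<close> (\<open>lipschitz_flip\<close>). Values at joined vertices
  have the same strict sign (\<open>cluster_pos\<close>), hence the component contains neither \<open>x\<close> nor \<open>y\<close>.
  The components depend only on \<open>\<bar>E\<bar>\<close>, which is why flipping is an involution (\<open>flip_flip\<close>)
  and the resulting map on pairs is injective.
\<close>

section \<open>Sign flips of Lipschitz functions\<close>

text \<open>A set of triples, rather than a distance function, allows missing and multiple
  bounds between two vertices.\<close>

definition lipschitz_wrt :: "('v \<times> 'v \<times> int) set \<Rightarrow> ('v \<Rightarrow> int) \<Rightarrow> bool" where
  "lipschitz_wrt K E \<longleftrightarrow> (\<forall>(v, w, c)\<in>K. \<bar>E v - E w\<bar> \<le> c)"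

text \<open>The bonds are the pairs whose condition is violated when the two values
  have opposite signs.\<close>

definition bonds :: "('v \<times> 'v \<times> int) set \<Rightarrow> ('v \<Rightarrow> int) \<Rightarrow> ('v \<times> 'v) set" where
  "bonds K E = {(v, w). \<exists>c. (v, w, c) \<in> K \<and> c < \<bar>E v\<bar> + \<bar>E w\<bar>}"

definition cluster :: "('v \<times> 'v \<times> int) set \<Rightarrow> 'v \<Rightarrow> ('v \<Rightarrow> int) \<Rightarrow> 'v set" where
  "cluster K r E = (bonds K E \<union> (bonds K E)\<inverse>)\<^sup>* `` {r}"

definition flip :: "('v \<times> 'v \<times> int) set \<Rightarrow> 'v \<Rightarrow> ('v \<Rightarrow> int) \<Rightarrow> 'v \<Rightarrow> int" where
  "flip K r E v = (if v \<in> cluster K r E then - E v else E v)"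

lemma root_in_cluster: "r \<in> cluster K r E"
  by (simp add: cluster_def)

lemma abs_flip: "\<bar>flip K r E v\<bar> = \<bar>E v\<bar>"
  by (simp add: flip_def)

lemma cluster_flip: "cluster K r (flip K r E) = cluster K r E"
  by (simp add: cluster_def bonds_def abs_flip)

lemma flip_flip: "flip K r (flip K r E) = E"
proof
  fix v
  show "flip K r (flip K r E) v = E v"
    unfolding flip_def[of K r "flip K r E"] cluster_flip by (simp add: flip_def)
qed

lemma bond_in_cluster_iff:
  assumes "(v, w) \<in> bonds K E"
  shows "v \<in> cluster K r E \<longleftrightarrow> w \<in> cluster K r E"
  using assms unfolding cluster_def
  by (auto intro: rtrancl_into_rtrancl)

text \<open>A condition between a vertex of the cluster and one outside it is not a bond, so it
  holds for every choice of signs; all other conditions see a common sign change or none.\<close>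

lemma lipschitz_flip:
  assumes "lipschitz_wrt K E"
  shows "lipschitz_wrt K (flip K r E)"
  unfolding lipschitz_wrt_def
proof clarify
  fix v w c
  assume K: "(v, w, c) \<in> K"
  have lip: "\<bar>E v - E w\<bar> \<le> c"
    using assms K by (auto simp: lipschitz_wrt_def)
  show "\<bar>flip K r E v - flip K r E w\<bar> \<le> c"
  proof (cases "(v, w) \<in> bonds K E")
    case True
    then show ?thesis
      using lip bond_in_cluster_iff[OF True, of r] by (auto simp: flip_def)
  next
    case False
    then have "\<bar>E v\<bar> + \<bar>E w\<bar> \<le> c"
      using K by (force simp: bonds_def)
    then show ?thesis
      using abs_flip[of K r E v] abs_flip[of K r E w] by linarith
  qed
qed

text \<open>At the two ends of a bond, \<open>\<bar>E v - E w\<bar> < \<bar>E v\<bar> + \<bar>E w\<bar>\<close>, which forces equal nonzero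
  signs; this propagates along paths of bonds.\<close>

lemma cluster_pos:
  assumes "lipschitz_wrt K E" and "E r > 0" and "v \<in> cluster K r E"
  shows "E v > 0"
proof -
  have "(r, v) \<in> (bonds K E \<union> (bonds K E)\<inverse>)\<^sup>*"
    using assms(3) by (simp add: cluster_def)
  then show ?thesis
  proof (induction rule: rtrancl_induct)
    case base
    show ?case by (fact assms(2))
  next
    case (step v w)
    from step.hyps(2) have "\<bar>E v - E w\<bar> < \<bar>E v\<bar> + \<bar>E w\<bar>"
      using assms(1) by (fastforce simp: bonds_def lipschitz_wrt_def)
    then show ?case
      using step.IH by linarith
  qed
qed

section \<open>Pairs of order preserving maps with a given sum\<close>

text \<open>The vertex \<open>None\<close> is the additional one that carries the bounds \<open>0\<close> and \<open>t\<close>.\<close>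

definition pair_constraints ::
  "'a set \<Rightarrow> ('a \<Rightarrow> 'a \<Rightarrow> bool) \<Rightarrow> nat \<Rightarrow> ('a \<Rightarrow> nat) \<Rightarrow> ('a option \<times> 'a option \<times> int) set" where
  "pair_constraints X prec t S =
     {(Some v, Some w, int (S w) - int (S v)) |v w. v \<in> X \<and> w \<in> X \<and> prec v w}
     \<union> {(None, Some v, int (S v)) |v. v \<in> X}
     \<union> {(None, Some v, 2 * int t - int (S v)) |v. v \<in> X}"

text \<open>This is \<open>B - A\<close>, with value \<open>0\<close> at \<open>None\<close>, normalised to vanish at \<open>y\<close> so that a sign
  flip preserves the normalisation. The default \<open>0\<close> outside of \<open>X\<close> is also preserved by flips,
  which makes the gap of the new pair equal to the flipped gap as a function on all vertices.\<close>

fun gap :: "'a set \<Rightarrow> 'a \<Rightarrow> ('a \<Rightarrow> nat) \<Rightarrow> ('a \<Rightarrow> nat) \<Rightarrow> 'a option \<Rightarrow> int" where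
  "gap X y A B None = int (A y) - int (B y)"
| "gap X y A B (Some v) =
     (if v \<in> X then (int (B v) - int (A v)) - (int (B y) - int (A y)) else 0)"

text \<open>Written in terms of the sum and the difference of the two maps, each condition on the
  pair is the conjunction of the same linear inequality for \<open>A\<close> and for \<open>B\<close>, that is, a bound on
  an absolute value.\<close>

lemma PP_pair_iff_lipschitz:
  assumes "A \<in> extensional X" and "B \<in> extensional X"
  shows "A \<in> PP X prec t \<and> B \<in> PP X prec t \<longleftrightarrow>
    lipschitz_wrt (pair_constraints X prec t (\<lambda>v. A v + B v)) (gap X y A B)"
proof -
  have "lipschitz_wrt (pair_constraints X prec t (\<lambda>v. A v + B v)) (gap X y A B) \<longleftrightarrow>
      (\<forall>v\<in>X. \<forall>w\<in>X. prec v w \<longrightarrow> \<bar>gap X y A B (Some v) - gap X y A B (Some w)\<bar>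
                                   \<le> int (A w + B w) - int (A v + B v)) \<and>
      (\<forall>v\<in>X. \<bar>gap X y A B None - gap X y A B (Some v)\<bar> \<le> int (A v + B v)) \<and>
      (\<forall>v\<in>X. \<bar>gap X y A B None - gap X y A B (Some v)\<bar> \<le> 2 * int t - int (A v + B v))"
    unfolding lipschitz_wrt_def pair_constraints_def by fast
  also have "\<dots> \<longleftrightarrow>
      (\<forall>v\<in>X. \<forall>w\<in>X. prec v w \<longrightarrow> A v \<le> A w \<and> B v \<le> B w) \<and> (\<forall>v\<in>X. A v \<le> t \<and> B v \<le> t)"
  proof -
    have order: "\<bar>gap X y A B (Some v) - gap X y A B (Some w)\<bar> \<le> int (A w + B w) - int (A v + B v)
        \<longleftrightarrow> A v \<le> A w \<and> B v \<le> B w" if "v \<in> X" "w \<in> X" for v w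
      using that by auto
    have lower: "\<bar>gap X y A B None - gap X y A B (Some v)\<bar> \<le> int (A v + B v)" if "v \<in> X" for v
      using that by auto
    have upper: "\<bar>gap X y A B None - gap X y A B (Some v)\<bar> \<le> 2 * int t - int (A v + B v)
        \<longleftrightarrow> A v \<le> t \<and> B v \<le> t" if "v \<in> X" for v
      using that by auto
    show ?thesis
      using order lower upper by meson
  qed
  also have "\<dots> \<longleftrightarrow> A \<in> PP X prec t \<and> B \<in> PP X prec t"
    using assms by (auto simp: PP_def PiE_iff)
  finally show ?thesis by simp
qed

text \<open>These recover the two maps from their sum and any translate of their difference.\<close>

definition lower_part :: "'a set \<Rightarrow> ('a \<Rightarrow> nat) \<Rightarrow> ('a option \<Rightarrow> int) \<Rightarrow> 'a \<Rightarrow> nat" where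
  "lower_part X S E = (\<lambda>v\<in>X. nat ((int (S v) - (E (Some v) - E None)) div 2))"

definition upper_part :: "'a set \<Rightarrow> ('a \<Rightarrow> nat) \<Rightarrow> ('a option \<Rightarrow> int) \<Rightarrow> 'a \<Rightarrow> nat" where
  "upper_part X S E = (\<lambda>v\<in>X. nat ((int (S v) + (E (Some v) - E None)) div 2))"

text \<open>Parity makes the halves integral, and the Lipschitz bounds at \<open>None\<close> make them
  nonnegative.\<close>

lemma parts_sum_diff:
  assumes lip: "lipschitz_wrt (pair_constraints X prec t S) E"
    and parity: "even (int (S v) + (E (Some v) - E None))"
    and v: "v \<in> X"
  shows "lower_part X S E v + upper_part X S E v = S v"
    and "int (upper_part X S E v) - int (lower_part X S E v) = E (Some v) - E None"
proof -
  have "(None, Some v, int (S v)) \<in> pair_constraints X prec t S"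
    using v by (auto simp: pair_constraints_def)
  then have bound: "\<bar>E None - E (Some v)\<bar> \<le> int (S v)"
    using lip by (auto simp: lipschitz_wrt_def)
  obtain b where b: "int (S v) + (E (Some v) - E None) = 2 * b"
    using parity by (elim evenE)
  then have a: "int (S v) - (E (Some v) - E None) = 2 * (int (S v) - b)"
    by simp
  have low: "lower_part X S E v = nat (int (S v) - b)"
    using v unfolding lower_part_def by (simp only: restrict_apply' a) simp
  have up: "upper_part X S E v = nat b"
    using v unfolding upper_part_def by (simp only: restrict_apply' b)
  have "0 \<le> b" "b \<le> int (S v)"
    using bound b by linarith+
  then show "lower_part X S E v + upper_part X S E v = S v"
    and "int (upper_part X S E v) - int (lower_part X S E v) = E (Some v) - E None"
    using b unfolding low up by linarith+
qed

lemma parts_gap: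
  assumes "A \<in> extensional X" and "B \<in> extensional X"
  shows "lower_part X (\<lambda>v. A v + B v) (gap X y A B) = A"
    and "upper_part X (\<lambda>v. A v + B v) (gap X y A B) = B"
  using assms by (auto simp: lower_part_def upper_part_def extensional_def fun_eq_iff)

section \<open>The injection between pairs\<close>

definition flipped_gap ::
  "'a set \<Rightarrow> ('a \<Rightarrow> 'a \<Rightarrow> bool) \<Rightarrow> nat \<Rightarrow> 'a \<Rightarrow> 'a \<Rightarrow> ('a \<Rightarrow> nat) \<Rightarrow> ('a \<Rightarrow> nat) \<Rightarrow> 'a option \<Rightarrow> int" where
  "flipped_gap X prec t y z A B =
     flip (pair_constraints X prec t (\<lambda>v. A v + B v)) (Some z) (gap X y A B)"

definition flip_pair ::
  "'a set \<Rightarrow> ('a \<Rightarrow> 'a \<Rightarrow> bool) \<Rightarrow> nat \<Rightarrow> 'a \<Rightarrow> 'a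
     \<Rightarrow> ('a \<Rightarrow> nat) \<times> ('a \<Rightarrow> nat) \<Rightarrow> ('a \<Rightarrow> nat) \<times> ('a \<Rightarrow> nat)" where
  "flip_pair X prec t y z = (\<lambda>(A, B).
     (lower_part X (\<lambda>v. A v + B v) (flipped_gap X prec t y z A B),
      upper_part X (\<lambda>v. A v + B v) (flipped_gap X prec t y z A B)))"

text \<open>The normalised difference of the new pair is the flipped one because a flip cannot
  change the value \<open>0\<close> at \<open>y\<close>.\<close>

lemma flip_pair_properties:
  assumes A: "A \<in> PP X prec t" and B: "B \<in> PP X prec t" and y: "y \<in> X"
    and pair: "flip_pair X prec t y z (A, B) = (A', B')"
  shows flip_pair_sum: "A' v + B' v = A v + B v"
    and flip_pair_gap: "gap X y A' B' = flipped_gap X prec t y z A B"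
    and flip_pair_PP: "A' \<in> PP X prec t" "B' \<in> PP X prec t"
proof -
  define S where "S = (\<lambda>v. A v + B v)"
  define E where "E = gap X y A B"
  define E' where "E' = flipped_gap X prec t y z A B"
  have ext: "A \<in> extensional X" "B \<in> extensional X"
    using A B by (auto simp: PP_def PiE_def)
  have A': "A' = lower_part X S E'" and B': "B' = upper_part X S E'"
    using pair by (auto simp: flip_pair_def S_def E'_def)
  have ext': "A' \<in> extensional X" "B' \<in> extensional X"
    by (auto simp: A' B' lower_part_def upper_part_def)
  have E'_flip: "E' = flip (pair_constraints X prec t S) (Some z) E"
    by (simp add: E'_def flipped_gap_def S_def E_def)
  have lip: "lipschitz_wrt (pair_constraints X prec t S) E'"
    unfolding E'_flip
    using A B PP_pair_iff_lipschitz[OF ext] by (intro lipschitz_flip) (auto simp: S_def E_def)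
  have E'_cases: "E' u = E u \<or> E' u = - E u" for u
    by (auto simp: E'_flip flip_def)
  have parity: "even (int (S u) + (E' (Some u) - E' None))" if "u \<in> X" for u
  proof -
    have "even (int (S u) + (E (Some u) - E None))"
      using that by (simp add: S_def E_def)
    then show ?thesis
      using E'_cases[of "Some u"] E'_cases[of None] by auto
  qed
  note parts = parts_sum_diff[OF lip parity, folded A' B']
  have sum: "A' v + B' v = A v + B v" for v
    using parts(1)[of v] ext ext' by (cases "v \<in> X") (auto simp: S_def extensional_def)
  have E'_y: "E' (Some y) = 0"
    using E'_cases[of "Some y"] y by (simp add: E_def)
  have gap: "gap X y A' B' = E'"
  proof
    fix u
    show "gap X y A' B' u = E' u"
    proof (cases u)
      case None
      then show ?thesis
        using parts(2)[OF y y] E'_y by simp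
    next
      case (Some v)
      then show ?thesis
        using parts(2)[of v] parts(2)[OF y y] E'_y E'_cases[of "Some v"] by (auto simp: E_def)
    qed
  qed
  show "A' v + B' v = A v + B v"
    by (fact sum)
  show "gap X y A' B' = flipped_gap X prec t y z A B"
    using gap by (simp add: E'_def)
  have "lipschitz_wrt (pair_constraints X prec t (\<lambda>v. A' v + B' v)) (gap X y A' B')"
    using lip by (simp add: gap sum S_def)
  then show "A' \<in> PP X prec t" and "B' \<in> PP X prec t"
    using PP_pair_iff_lipschitz[OF ext'] by blast+
qed

text \<open>The image determines the sum and the flipped normalised difference; since flipping is an
  involution, both maps can be recovered.\<close>

lemma inj_on_flip_pair:
  assumes y: "y \<in> X"
  shows "inj_on (flip_pair X prec t y z) (PP X prec t \<times> PP X prec t)"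
proof (rule inj_onI, clarify)
  fix A B C D
  assume A: "A \<in> PP X prec t" and B: "B \<in> PP X prec t"
    and C: "C \<in> PP X prec t" and D: "D \<in> PP X prec t"
    and eq: "flip_pair X prec t y z (A, B) = flip_pair X prec t y z (C, D)"
  obtain A' B' where AB: "flip_pair X prec t y z (A, B) = (A', B')"
    by fastforce
  with eq have CD: "flip_pair X prec t y z (C, D) = (A', B')"
    by simp
  have sum: "(\<lambda>v. A v + B v) = (\<lambda>v. C v + D v)"
    using flip_pair_sum[OF A B y AB] flip_pair_sum[OF C D y CD] by auto
  have "flipped_gap X prec t y z A B = flipped_gap X prec t y z C D"
    using flip_pair_gap[OF A B y AB] flip_pair_gap[OF C D y CD] by simp
  then have gap: "gap X y A B = gap X y C D"
    unfolding flipped_gap_def sum by (metis flip_flip)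
  have ext: "A \<in> extensional X" "B \<in> extensional X" "C \<in> extensional X" "D \<in> extensional X"
    using A B C D by (auto simp: PP_def PiE_def)
  show "A = C \<and> B = D"
    using parts_gap[OF ext(1,2), of y] parts_gap[OF ext(3,4), of y] unfolding sum gap by simp
qed

text \<open>The cluster of \<open>z\<close> consists of vertices with positive normalised difference. As this is
  \<open>-1\<close> at \<open>x\<close>, the flip changes the step from \<open>y\<close> to \<open>z\<close> but not the one from \<open>x\<close> to \<open>y\<close>.\<close>

lemma flip_pair_SPP:
  assumes X: "x \<in> X" "y \<in> X" "z \<in> X"
    and A: "A \<in> SPP X prec t x y z k l" and B: "B \<in> SPP X prec t x y z (k + 1) (l + 1)"
    and pair: "flip_pair X prec t y z (A, B) = (A', B')"
  shows "A' \<in> SPP X prec t x y z k (l + 1)" and "B' \<in> SPP X prec t x y z (k + 1) l"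
proof -
  define K where "K = pair_constraints X prec t (\<lambda>v. A v + B v)"
  have PP: "A \<in> PP X prec t" "B \<in> PP X prec t"
    using A B by (auto simp: SPP_def)
  then have ext: "A \<in> extensional X" "B \<in> extensional X"
    by (auto simp: PP_def PiE_def)
  note sum = flip_pair_sum[OF PP X(2) pair]
  have lip: "lipschitz_wrt K (gap X y A B)"
    using PP PP_pair_iff_lipschitz[OF ext] by (auto simp: K_def)
  have gap_x: "gap X y A B (Some x) = -1" and gap_z: "gap X y A B (Some z) = 1"
    using A B X by (auto simp: SPP_def)
  have "Some x \<notin> cluster K (Some z) (gap X y A B)"
    using cluster_pos[OF lip, of "Some z" "Some x"] gap_x gap_z by linarith
  then have "gap X y A' B' (Some x) = -1" "gap X y A' B' (Some z) = -1"
    using gap_x gap_z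
    by (simp_all add: flip_pair_gap[OF PP X(2) pair] flipped_gap_def flip_def
        root_in_cluster flip: K_def)
  then have "(int (B' x) - int (A' x)) - (int (B' y) - int (A' y)) = -1"
    "(int (B' z) - int (A' z)) - (int (B' y) - int (A' y)) = -1"
    using X by simp_all
  then show "A' \<in> SPP X prec t x y z k (l + 1)" and "B' \<in> SPP X prec t x y z (k + 1) l"
    using A B sum[of x] sum[of y] sum[of z] flip_pair_PP[OF PP X(2) pair]
    by (auto simp: SPP_def)
qed

section \<open>From the injection to the inequalities\<close>

lemma finite_PP: "finite X \<Longrightarrow> finite (PP X prec t)"
  by (rule finite_subset[OF _ finite_PiE[of X "\<lambda>_. {0..t}"]]) (auto simp: PP_def)

lemma finite_SPP: "finite X \<Longrightarrow> finite (SPP X prec t x y z k l)"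
  by (rule finite_subset[OF _ finite_PP]) (auto simp: SPP_def)

lemma inj_on_flip_pair_SPP:
  assumes "x \<in> X" "y \<in> X" "z \<in> X"
  shows "inj_on (flip_pair X prec t y z)
      (SPP X prec t x y z k l \<times> SPP X prec t x y z (k + 1) (l + 1))"
  by (rule inj_on_subset[OF inj_on_flip_pair[OF assms(2)]]) (auto simp: SPP_def)

lemma flip_pair_image:
  assumes "x \<in> X" "y \<in> X" "z \<in> X"
  shows "flip_pair X prec t y z ` (SPP X prec t x y z k l \<times> SPP X prec t x y z (k + 1) (l + 1))
    \<subseteq> SPP X prec t x y z k (l + 1) \<times> SPP X prec t x y z (k + 1) l"
proof clarify
  fix A B A' B'
  assume "A \<in> SPP X prec t x y z k l" "B \<in> SPP X prec t x y z (k + 1) (l + 1)"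
    and "(A', B') = flip_pair X prec t y z (A, B)"
  then show "A' \<in> SPP X prec t x y z k (l + 1) \<and> B' \<in> SPP X prec t x y z (k + 1) l"
    using flip_pair_SPP[OF assms] by metis
qed

text \<open>For a weight whose product over a pair depends only on the pointwise sum, the terms of
  the smaller side cancel, leaving the pairs outside of the image of the injection.\<close>

lemma cross_product_difference:
  fixes wt :: "('a \<Rightarrow> nat) \<Rightarrow> 'b :: comm_ring_1"
  assumes X: "finite X" "x \<in> X" "y \<in> X" "z \<in> X"
    and wt: "\<And>A B A' B'. (\<And>v. A' v + B' v = A v + B v) \<Longrightarrow> wt A' * wt B' = wt A * wt B"
  shows "\<exists>R. sum wt (SPP X prec t x y z k (l + 1)) * sum wt (SPP X prec t x y z (k + 1) l)
      - sum wt (SPP X prec t x y z k l) * sum wt (SPP X prec t x y z (k + 1) (l + 1))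
      = (\<Sum>(A, B)\<in>R. wt A * wt B)"
proof -
  define M where "M = SPP X prec t x y z k l \<times> SPP X prec t x y z (k + 1) (l + 1)"
  define N where "N = SPP X prec t x y z k (l + 1) \<times> SPP X prec t x y z (k + 1) l"
  define \<phi> where "\<phi> = flip_pair X prec t y z"
  define w where "w = (\<lambda>(A, B). wt A * wt B)"
  have "finite N"
    using X(1) by (simp add: N_def finite_SPP)
  have sub: "\<phi> ` M \<subseteq> N" and inj: "inj_on \<phi> M"
    unfolding M_def N_def \<phi>_def
    by (rule flip_pair_image[OF X(2-4)], rule inj_on_flip_pair_SPP[OF X(2-4)])
  have w_\<phi>: "w (\<phi> p) = w p" if "p \<in> M" for p
  proof -
    obtain A B A' B' where p: "p = (A, B)" and p': "flip_pair X prec t y z (A, B) = (A', B')"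
      by (metis surj_pair)
    have "A \<in> PP X prec t" "B \<in> PP X prec t"
      using that by (auto simp: p M_def SPP_def)
    then show ?thesis
      using flip_pair_sum[OF _ _ X(3) p'] by (auto simp: w_def \<phi>_def p p' intro!: wt)
  qed
  have "sum w (\<phi> ` M) = sum w M"
    using sum.reindex[OF inj, of w] w_\<phi> by simp
  then have "sum w N - sum w M = sum w (N - \<phi> ` M)"
    using sum_diff[OF \<open>finite N\<close> sub, of w] by simp
  then show ?thesis
    by (auto simp: M_def N_def w_def sum_product sum.cartesian_product)
qed

text \<open>In this form the coefficients of a weight are visibly nonnegative.\<close>

lemma prod_qvar_power:
  "finite I \<Longrightarrow>
    (\<Prod>i\<in>I. qvar i ^ e i) = Poly_Mapping.single (\<Sum>i\<in>I. Poly_Mapping.single i (e i)) 1"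
proof (induction I rule: finite_induct)
  case empty
  show ?case by simp
next
  case (insert i I)
  have "qvar i ^ m = Poly_Mapping.single (Poly_Mapping.single i m) 1" for m
    by (induction m) (simp_all add: qvar_def mult_single single_add[symmetric])
  then show ?case
    using insert by (simp add: mult_single)
qed

theorem theorem10p1:
  fixes X :: "'a set" and prec :: "'a \<Rightarrow> 'a \<Rightarrow> bool"
    and x y z :: 'a and t k l :: nat
  assumes "finite_poset X prec"
    and "x \<in> X" and "y \<in> X" and "z \<in> X"
    and "x \<noteq> y" and "y \<noteq> z" and "x \<noteq> z"
    and "t \<ge> 1"
  shows "F X prec t x y z k (l + 1) * F X prec t x y z (k + 1) l
           \<ge> F X prec t x y z k l * F X prec t x y z (k + 1) (l + 1)
       \<and> Lambda_q X prec t x y z k (l + 1) * Lambda_q X prec t x y z (k + 1) l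
           \<ge>\<^sub>q Lambda_q X prec t x y z k l * Lambda_q X prec t x y z (k + 1) (l + 1)
       \<and> (\<forall>n lab. natural_labeling X prec n lab \<longrightarrow>
            Lambda_qs X prec n lab t x y z k (l + 1) * Lambda_qs X prec n lab t x y z (k + 1) l
              \<ge>\<^sub>q\<^sub>s Lambda_qs X prec n lab t x y z k l * Lambda_qs X prec n lab t x y z (k + 1) (l + 1))"
proof (intro conjI allI impI)
  have fin: "finite X"
    using assms(1) by (simp add: finite_poset_def)
  note X = assms(2-4)
  show "F X prec t x y z k (l + 1) * F X prec t x y z (k + 1) l
      \<ge> F X prec t x y z k l * F X prec t x y z (k + 1) (l + 1)"
    using card_inj_on_le[OF inj_on_flip_pair_SPP[OF X] flip_pair_image[OF X]] fin
    by (simp add: F_def card_cartesian_product finite_SPP)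
  show "Lambda_q X prec t x y z k (l + 1) * Lambda_q X prec t x y z (k + 1) l
      \<ge>\<^sub>q Lambda_q X prec t x y z k l * Lambda_q X prec t x y z (k + 1) (l + 1)"
  proof -
    let ?wt = "\<lambda>T. monom 1 (\<Sum>v\<in>X. T v) :: real poly"
    have "?wt A' * ?wt B' = ?wt A * ?wt B" if "\<And>v. A' v + B' v = A v + B v" for A B A' B'
      using that by (simp add: mult_monom flip: sum.distrib)
    from cross_product_difference[where wt = ?wt, OF fin X this]
    obtain R where "Lambda_q X prec t x y z k (l + 1) * Lambda_q X prec t x y z (k + 1) l
        - Lambda_q X prec t x y z k l * Lambda_q X prec t x y z (k + 1) (l + 1)
        = (\<Sum>(A, B)\<in>R. ?wt A * ?wt B)"
      unfolding Lambda_q_def by blast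
    then show ?thesis
      by (auto simp: geq_q_def coeff_sum mult_monom split_beta intro!: sum_nonneg)
  qed
  fix n lab
  assume "natural_labeling X prec n lab"
  show "Lambda_qs X prec n lab t x y z k (l + 1) * Lambda_qs X prec n lab t x y z (k + 1) l
      \<ge>\<^sub>q\<^sub>s Lambda_qs X prec n lab t x y z k l * Lambda_qs X prec n lab t x y z (k + 1) (l + 1)"
  proof -
    let ?wt = "\<lambda>T. \<Prod>i=1..n. qvar i ^ T (lab i)"
    have "?wt A' * ?wt B' = ?wt A * ?wt B" if "\<And>v. A' v + B' v = A v + B v" for A B A' B'
      using that by (simp flip: prod.distrib power_add)
    from cross_product_difference[where wt = ?wt, OF fin X this]
    obtain R where "Lambda_qs X prec n lab t x y z k (l + 1) * Lambda_qs X prec n lab t x y z (k + 1) l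
        - Lambda_qs X prec n lab t x y z k l * Lambda_qs X prec n lab t x y z (k + 1) (l + 1)
        = (\<Sum>(A, B)\<in>R. ?wt A * ?wt B)"
      unfolding Lambda_qs_def by blast
    then show ?thesis
      by (auto simp: geq_qs_def lookup_sum prod_qvar_power mult_single lookup_single when_def
          split_beta intro!: sum_nonneg)
  qed
qed

end
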